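(* Let $\tilde\delta$ be an $n$-variate normally distributed random vector with mean $\mathbf{0}$ and invertible covariance matrix $\Sigma\in\mathbb{R}^{n\times n}$ with $\Sigma_{ii}=1$ for all $i\in[n]$. Let $E$ be the edge set of an undirected graph on $[n]$, let $\mathcal{Z}\subseteq\mathbb{R}^{n_x}_+\times\mathbb{R}^{n_y}_+$, and for $i\in[m]$ let $C^i\in\mathbb{R}^{n\times n_x}$, $d_i\in\mathbb{R}^{n_y}$, $c_i\in\mathbb{R}$. Let $p\in(0,1)$ and $$\beta=\min\left\{\sqrt{\chi^2_{1-p}(n)},\ Z_{1-p/(2(|E|+n))}\right\}.$$ Let $\gamma_{ij}\ge\beta\sqrt{e_{ij}^\top\Sigma e_{ij}}$ for all $i,j\in[n]$ such that $\{i,j\}\in E$ or $i=j$, and let $$\mathcal{U}_{\mathcal S}=\{\delta\in\mathbb{R}^n : |\delta_i|\le\gamma_{ii}\ \forall i\in[n],\ |\delta_i-\delta_j|\le\gamma_{ij}\ \forall \{i,j\}\in E\}.$$ Then for any $(x,y)\in\mathcal{Z}$ such that $\delta^\top C^ix+d_i^\top y\le c_i$ for all $i\in[m]$ and all $\delta\in\mathcal{U}_{\mathcal S}$, the probability that the constraints $\tilde\delta^\top C^ix+d_i^\top y\le c_i$, $i\in[m]$, are violated (i.e., that at least one of them fails) is at most $p$.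
   Context: $[n]=\{1,\dots,n\}$. $\chi^2_{1-p}(n)$ is the $1-p$ quantile of the $\chi^2$ distribution with $n$ degrees of freedom and $Z_q$ is the $q$ quantile of the standard normal distribution. With $e_i$ the standard unit vectors of $\mathbb{R}^n$, $e_{ij}=e_i-e_j$ if $i\ne j$ and $e_{ii}=e_i$. Edges of the graph join distinct vertices; $|E|$ counts undirected edges; $\gamma_{ij}=\gamma_{ji}$. *)

theory Defs
  imports "HOL-Probability.Probability"
begin

text \<open>Lower quantile of a probability distribution on the reals. For \<open>0 < q < 1\<close> the set is
  nonempty, bounded below, and its infimum is attained because the cdf is right-continuous.\<close>

definition quantile :: "real measure \<Rightarrow> real \<Rightarrow> real" where
  "quantile D q = Inf {x. q \<le> cdf D x}"

text \<open>The chi-square distribution with \<open>k\<close> degrees of freedom: the law of the sum of squares of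
  \<open>k\<close> independent standard normal variables.\<close>

definition chi_square_distribution :: "nat \<Rightarrow> real measure" where
  "chi_square_distribution k =
     distr (Pi\<^sub>M {..<k} (\<lambda>_. std_normal_distribution)) borel (\<lambda>z. \<Sum>i<k. (z i)\<^sup>2)"

text \<open>A random vector is multivariate normal if it has the law of \<open>b + A z\<close>, where the components
  of \<open>z\<close> are independent standard normal variables. Degenerate laws are included, and restricting
  to square \<open>A\<close> loses nothing, since every positive semidefinite \<open>S\<close> equals \<open>A A\<^sup>T\<close> for
  some square \<open>A\<close>.\<close>

definition normal_random_vector :: "'a measure \<Rightarrow> ('a \<Rightarrow> real ^ 'n) \<Rightarrow> bool" where
  "normal_random_vector M X \<longleftrightarrow>
     X \<in> borel_measurable M \<and>
     (\<exists>(b :: real ^ 'n) (A :: real ^ 'n ^ 'n).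
        distr M borel X =
        distr (Pi\<^sub>M UNIV (\<lambda>_ :: 'n. std_normal_distribution)) borel
          (\<lambda>z. b + A *v (\<chi> i. z i)))"

definition mean_vector :: "'a measure \<Rightarrow> ('a \<Rightarrow> real ^ 'n) \<Rightarrow> real ^ 'n" where
  "mean_vector M X = (\<chi> i. \<integral>\<omega>. X \<omega> $ i \<partial>M)"

definition covariance_matrix :: "'a measure \<Rightarrow> ('a \<Rightarrow> real ^ 'n) \<Rightarrow> real ^ 'n ^ 'n" where
  "covariance_matrix M X =
     (\<chi> i j. \<integral>\<omega>. (X \<omega> $ i - mean_vector M X $ i) * (X \<omega> $ j - mean_vector M X $ j) \<partial>M)"

definition edge_vector :: "'n \<Rightarrow> 'n \<Rightarrow> real ^ 'n" where
  "edge_vector i j = (if i = j then axis i 1 else axis i 1 - axis j 1)"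

text \<open>An undirected graph on the vertex type is given by its set \<open>E\<close> of two-element edges.\<close>

definition uncertainty_set :: "'n set set \<Rightarrow> ('n \<Rightarrow> 'n \<Rightarrow> real) \<Rightarrow> (real ^ 'n) set" where
  "uncertainty_set E \<gamma> =
     {\<delta>. (\<forall>i. \<bar>\<delta> $ i\<bar> \<le> \<gamma> i i) \<and> (\<forall>i j. {i, j} \<in> E \<longrightarrow> \<bar>\<delta> $ i - \<delta> $ j\<bar> \<le> \<gamma> i j)}"

end

theory Submission
  imports Defs
begin

text \<open>
  The constraints hold whenever the random vector falls into the uncertainty set, so it suffices
  that it leaves this set with probability at most \<open>p\<close>. Write the centred vector as
  \<open>A z\<close> with independent standard normal components of \<open>z\<close>; then \<open>\<Sigma> = A A\<^sup>T\<close>,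
  and a linear form \<open>v\<close> of the random vector is the form \<open>w = A\<^sup>T v\<close> of \<open>z\<close>, where
  the length of \<open>w\<close> is the standard deviation \<open>sqrt (v\<^sup>T \<Sigma> v)\<close>. The vector is thus in the
  uncertainty set as soon as each of at most \<open>|E| + n\<close> linear forms (the coordinates and one
  difference per edge) deviates from \<open>0\<close> by at most \<open>\<beta>\<close> standard deviations.

  The constant \<open>\<beta>\<close> is one of two numbers, and each of them is large enough for a reason
  of its own.

  \<^item> For the chi-square quantile \<open>q\<close> and \<open>\<beta> = sqrt q\<close>, the event that the squared length of
    \<open>z\<close> is at most \<open>q\<close> has probability at least \<open>1 - p\<close>, and on it the Cauchy-Schwarz
    inequality bounds every linear form at once by \<open>\<beta>\<close> standard deviations
    (\<open>centred_normal_ellipsoid_bound\<close>).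

  \<^item> For the normal quantile, a single form exceeds \<open>\<beta>\<close> standard deviations on either side with
    probability at most \<open>2 (p / (2 (|E| + n)))\<close>, because a form of length \<open>1\<close> in \<open>z\<close> is
    standard normal; the union bound over all forms gives \<open>p\<close>
    (\<open>centred_normal_union_bound\<close>).
\<close>

section \<open>Quantiles\<close>

text \<open>The infimum that defines the quantile is attained: the cdf is at least \<open>q\<close> at every point
  to the right of the infimum, and right-continuity carries the bound to the infimum itself. The
  limits of the cdf at both ends make the infimum meaningful, which is where \<open>0 < q < 1\<close>
  enters.\<close>

lemma le_cdf_quantile:
  assumes "real_distribution D" and "0 < q" and "q < 1"
  shows "q \<le> cdf D (quantile D q)"
proof -
  interpret real_distribution D by fact
  define S where "S = {x. q \<le> cdf D x}"
  have "eventually (\<lambda>x. q < cdf D x) at_top"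
    using order_tendstoD(1)[OF cdf_lim_at_top_prob] \<open>q < 1\<close> by blast
  then obtain x where "q < cdf D x"
    by (auto simp: eventually_at_top_linorder)
  hence ne: "S \<noteq> {}" by (auto simp: S_def intro: less_imp_le)
  have "eventually (\<lambda>x. cdf D x < q) at_bot"
    using order_tendstoD(2)[OF cdf_lim_at_bot] \<open>0 < q\<close> by blast
  then obtain l where l: "\<And>x. x \<le> l \<Longrightarrow> cdf D x < q"
    by (auto simp: eventually_at_bot_linorder)
  have bdd: "bdd_below S"
  proof (rule bdd_belowI[of _ l])
    fix x assume "x \<in> S"
    thus "l \<le> x" using l[of x] by (force simp: S_def)
  qed
  have above: "q \<le> cdf D x" if x: "Inf S < x" for x
  proof -
    obtain s where "s \<in> S" "s < x"
      using x cInf_less_iff[OF ne bdd, of x] by auto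
    thus ?thesis using cdf_nondecreasing[of s x] by (simp add: S_def)
  qed
  have "(cdf D \<longlongrightarrow> cdf D (Inf S)) (at_right (Inf S))"
    using cdf_is_right_cont[of "Inf S"] by (simp add: continuous_within)
  moreover have "eventually (\<lambda>x. q \<le> cdf D x) (at_right (Inf S))"
    unfolding eventually_at_filter by (auto intro: always_eventually above)
  ultimately have "q \<le> cdf D (Inf S)"
    by (rule tendsto_lowerbound) simp
  thus ?thesis by (simp add: quantile_def S_def)
qed

section \<open>Vectors of independent standard normal variables\<close>

abbreviation iid_normal :: "('n::finite \<Rightarrow> real) measure" where
  "iid_normal \<equiv> Pi\<^sub>M UNIV (\<lambda>_. std_normal_distribution)"

lemma prob_space_std_normal: "prob_space std_normal_distribution"
  by (rule prob_space_normal_density) simp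

lemma prob_space_iid_normal: "prob_space (iid_normal :: ('n::finite \<Rightarrow> real) measure)"
  by (intro prob_space_PiM prob_space_std_normal)

lemma measurable_iid_normal_coord [measurable]:
  "(\<lambda>z. z i) \<in> borel_measurable (iid_normal :: ('n::finite \<Rightarrow> real) measure)"
proof -
  have "(\<lambda>z. z i) \<in> measurable (iid_normal :: ('n \<Rightarrow> real) measure) std_normal_distribution"
    by (rule measurable_component_singleton) simp
  thus ?thesis by simp
qed

lemma measurable_iid_normal_linear_form [measurable]:
  "(\<lambda>z. w \<bullet> (\<chi> i. z i)) \<in> borel_measurable (iid_normal :: ('n::finite \<Rightarrow> real) measure)"
  unfolding inner_vec_def by simp

lemma measurable_vec_of_linear_forms:
  fixes f :: "'a \<Rightarrow> real ^ 'n"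
  assumes "\<And>v. (\<lambda>z. v \<bullet> f z) \<in> borel_measurable M"
  shows "f \<in> borel_measurable M"
  using assms by (subst borel_measurable_euclidean_space) (simp add: inner_commute)

lemma measurable_iid_normal_affine [measurable]:
  fixes A :: "real ^ 'n ^ 'k"
  shows "(\<lambda>z. b + A *v (\<chi> i. z i)) \<in> borel_measurable (iid_normal :: ('n::finite \<Rightarrow> real) measure)"
  by (rule measurable_vec_of_linear_forms)
     (simp add: inner_add_right dot_lmul_matrix[symmetric])

lemma iid_normal_coord_distr:
  "distr (iid_normal :: ('n::finite \<Rightarrow> real) measure) borel (\<lambda>z. z i) = std_normal_distribution"
proof -
  have "distr (iid_normal :: ('n \<Rightarrow> real) measure) borel (\<lambda>z. z i)
      = distr (iid_normal :: ('n \<Rightarrow> real) measure) std_normal_distribution (\<lambda>z. z i)"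
    by (rule distr_cong) auto
  also have "\<dots> = std_normal_distribution"
    by (rule distr_PiM_component) (auto intro: prob_space_std_normal)
  finally show ?thesis .
qed

lemma std_normal_moments:
  "integrable std_normal_distribution (\<lambda>x::real. x)"
  "integrable std_normal_distribution (\<lambda>x::real. x\<^sup>2)"
  "(\<integral>x. x \<partial>std_normal_distribution) = 0"
  "(\<integral>x. x\<^sup>2 \<partial>std_normal_distribution) = 1"
  using integrable_std_normal_distribution_moment[of 1] integrable_std_normal_distribution_moment[of 2]
    integral_std_normal_distribution_moment_odd[of 1] std_normal_distribution_even_moments(1)[of 1]
  by simp_all

lemma iid_normal_mean:
  "integrable (iid_normal :: ('n::finite \<Rightarrow> real) measure) (\<lambda>z. z i)"
  "(\<integral>z. z i \<partial>(iid_normal :: ('n::finite \<Rightarrow> real) measure)) = 0"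
proof -
  have "integrable (distr (iid_normal :: ('n \<Rightarrow> real) measure) borel (\<lambda>z. z i)) (\<lambda>x. x)"
    by (simp add: iid_normal_coord_distr std_normal_moments)
  thus "integrable (iid_normal :: ('n::finite \<Rightarrow> real) measure) (\<lambda>z. z i)"
    by (subst (asm) integrable_distr_eq) auto
  have "(\<integral>x. x \<partial>distr (iid_normal :: ('n \<Rightarrow> real) measure) borel (\<lambda>z. z i)) = 0"
    by (simp add: iid_normal_coord_distr std_normal_moments)
  thus "(\<integral>z. z i \<partial>(iid_normal :: ('n::finite \<Rightarrow> real) measure)) = 0"
    by (subst (asm) integral_distr) auto
qed

text \<open>A product of two coordinates is a product over all indices of functions of a single
  coordinate, most of them constantly \<open>1\<close>, so Fubini's theorem for finite products applies to
  the cases \<open>i = j\<close> and \<open>i \<noteq> j\<close> alike.\<close>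

lemma iid_normal_covariance:
  fixes i j :: "'n::finite"
  shows "integrable iid_normal (\<lambda>z. z i * z j)"
    and "(\<integral>z. z i * z j \<partial>iid_normal) = (if i = j then 1 else 0)"
proof -
  interpret product_sigma_finite "\<lambda>_::'n. std_normal_distribution"
    by (simp add: product_sigma_finite_def prob_space_imp_sigma_finite prob_space_std_normal)
  interpret N: prob_space std_normal_distribution by (rule prob_space_std_normal)
  define f :: "'n \<Rightarrow> real \<Rightarrow> real"
    where "f k x = (if k = i then x else 1) * (if k = j then x else 1)" for k x
  have prod_f: "(\<Prod>k\<in>UNIV. f k (z k)) = z i * z j" for z
    by (simp add: f_def prod.distrib prod.delta)
  have int: "integrable std_normal_distribution (f k)" for k
    using std_normal_moments(1,2) unfolding f_def
    by (cases "k = i"; cases "k = j") (simp_all add: power2_eq_square)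
  show "integrable iid_normal (\<lambda>z. z i * z j)"
    using product_integrable_prod[of UNIV f] int by (simp add: prod_f)
  \<comment> \<open>The value \<open>0\<close> arises when \<open>k\<close> is exactly one of \<open>i\<close> and \<open>j\<close>: the factor is then a
    first moment.\<close>
  have ev: "(\<integral>x. f k x \<partial>std_normal_distribution) = (if (k = i) = (k = j) then 1 else 0)" for k
    using std_normal_moments(3,4) N.prob_space unfolding f_def
    by (cases "k = i"; cases "k = j") (simp_all add: power2_eq_square)
  have "(\<integral>z. z i * z j \<partial>iid_normal) = (\<Prod>k\<in>UNIV. \<integral>x. f k x \<partial>std_normal_distribution)"
    using product_integral_prod[of UNIV f] int by (simp add: prod_f)
  also have "\<dots> = (if i = j then 1 else 0)"
    by (auto simp: ev intro!: prod_zero)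
  finally show "(\<integral>z. z i * z j \<partial>iid_normal) = (if i = j then 1 else 0)" .
qed

lemma iid_normal_indep_vars:
  "prob_space.indep_vars (iid_normal :: ('n::finite \<Rightarrow> real) measure) (\<lambda>_. borel) (\<lambda>i z. z i) UNIV"
proof -
  interpret prob_space "iid_normal :: ('n \<Rightarrow> real) measure" by (rule prob_space_iid_normal)
  have "distr iid_normal (\<Pi>\<^sub>M i\<in>(UNIV::'n set). borel) (\<lambda>z. z) = distr iid_normal iid_normal (\<lambda>z. z)"
    by (rule distr_cong) (auto intro!: sets_PiM_cong)
  thus ?thesis
    by (subst indep_vars_iff_distr_eq_PiM') (auto simp: iid_normal_coord_distr distr_id restrict_UNIV)
qed

text \<open>This is the closure of normal laws under independent sums. The variances of the summands
  \<open>u\<^sub>i z\<^sub>i\<close> are \<open>u\<^sub>i\<^sup>2\<close> and add up to the squared length of \<open>u\<close>. The closure result is about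
  laws with a density, so the summands with \<open>u\<^sub>i = 0\<close>, which have none, are left out first.\<close>

lemma iid_normal_unit_form_distr:
  fixes u :: "real ^ 'n"
  assumes "norm u = 1"
  shows "distr iid_normal borel (\<lambda>z. u \<bullet> (\<chi> i. z i)) = std_normal_distribution"
proof -
  interpret prob_space "iid_normal :: ('n \<Rightarrow> real) measure" by (rule prob_space_iid_normal)
  define I where "I = {i. u $ i \<noteq> 0}"
  have "u \<noteq> 0" using assms by auto
  hence "I \<noteq> {}" by (auto simp: I_def vec_eq_iff)
  have "distributed iid_normal lborel (\<lambda>z. \<Sum>i\<in>I. u $ i * z i)
          (normal_density (\<Sum>i\<in>I. 0) (sqrt (\<Sum>i\<in>I. \<bar>u $ i\<bar>\<^sup>2)))"
  proof (rule sum_indep_normal)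
    have "indep_vars (\<lambda>_. borel) (\<lambda>i z. u $ i * z i) UNIV"
      by (rule indep_vars_compose2[OF iid_normal_indep_vars]) simp
    thus "indep_vars (\<lambda>_. borel) (\<lambda>i z. u $ i * z i) I"
      by (rule indep_vars_subset) simp
    fix i assume "i \<in> I"
    have "distributed iid_normal lborel (\<lambda>z. z i) std_normal_density"
      unfolding distributed_def
      using iid_normal_coord_distr[of i] by (simp cong: distr_cong)
    from normal_density_affine[OF this, of "u $ i" 0] \<open>i \<in> I\<close>
    show "distributed iid_normal lborel (\<lambda>z. u $ i * z i) (normal_density 0 \<bar>u $ i\<bar>)"
      by (simp add: I_def)
  qed (use \<open>I \<noteq> {}\<close> in \<open>auto simp: I_def\<close>)
  moreover have "(\<Sum>i\<in>I. u $ i * z i) = u \<bullet> (\<chi> i. z i)" for z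
    unfolding inner_vec_def by (auto simp: I_def intro!: sum.mono_neutral_left)
  moreover have "(\<Sum>i\<in>I. \<bar>u $ i\<bar>\<^sup>2) = (\<Sum>i\<in>UNIV. (u $ i)\<^sup>2)"
    by (auto simp: I_def intro!: sum.mono_neutral_cong_left)
  hence "sqrt (\<Sum>i\<in>I. \<bar>u $ i\<bar>\<^sup>2) = 1"
    using assms by (simp add: norm_vec_def L2_set_def)
  ultimately have "distributed iid_normal lborel (\<lambda>z. u \<bullet> (\<chi> i. z i)) std_normal_density"
    by simp
  thus ?thesis by (simp add: distributed_def cong: distr_cong)
qed

text \<open>After scaling \<open>w\<close> to length \<open>1\<close>, the form exceeds the bound on one of two sides. The lower
  side is the upper side of the form \<open>- w\<close>, which has the same length. For \<open>w = 0\<close> the event is empty, whatever the sign of \<open>\<beta>\<close>; this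
  case covers degenerate linear forms.\<close>

lemma iid_normal_form_tail:
  fixes w :: "real ^ 'n"
  shows "measure iid_normal {z. \<beta> * norm w < \<bar>w \<bullet> (\<chi> i. z i)\<bar>}
           \<le> 2 * (1 - cdf std_normal_distribution \<beta>)"
proof -
  interpret prob_space "iid_normal :: ('n \<Rightarrow> real) measure" by (rule prob_space_iid_normal)
  interpret N: real_distribution std_normal_distribution by (rule real_dist_normal_dist)
  have space: "space (iid_normal :: ('n \<Rightarrow> real) measure) = UNIV"
    by (simp add: space_PiM)
  have half_space: "{z. \<beta> < u \<bullet> (\<chi> i. z i)} \<in> events" for u :: "real ^ 'n"
    using borel_measurable_less[OF borel_measurable_const measurable_iid_normal_linear_form, of \<beta> u]
    by (simp add: space)
  show ?thesis
  proof (cases "w = 0")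
    case True
    thus ?thesis using N.cdf_bounded_prob by simp
  next
    case False
    have one_sided: "measure iid_normal {z. \<beta> < u \<bullet> (\<chi> i. z i)} = 1 - cdf std_normal_distribution \<beta>"
      if "norm u = 1" for u :: "real ^ 'n"
    proof -
      have "measure iid_normal {z. \<beta> < u \<bullet> (\<chi> i. z i)}
          = measure (distr iid_normal borel (\<lambda>z. u \<bullet> (\<chi> i. z i))) {\<beta><..}"
        by (subst measure_distr) (auto simp: space intro!: arg_cong[where f = "measure _"])
      also have "\<dots> = measure std_normal_distribution (space std_normal_distribution - {..\<beta>})"
        using iid_normal_unit_form_distr[OF that]
        by (auto intro!: arg_cong2[where f = measure])
      also have "\<dots> = 1 - cdf std_normal_distribution \<beta>"
        by (subst N.prob_compl) (auto simp: cdf_def)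
      finally show ?thesis .
    qed
    define u where "u = w /\<^sub>R norm w"
    have u: "norm u = 1" "norm (- u) = 1" and w: "w = norm w *\<^sub>R u"
      using False by (simp_all add: u_def)
    have "w \<bullet> v = norm w * (u \<bullet> v)" for v
      by (subst w) simp
    hence "\<beta> * norm w < \<bar>w \<bullet> v\<bar> \<longleftrightarrow> \<beta> < \<bar>u \<bullet> v\<bar>" for v
      using False by (simp add: abs_mult mult.commute[of \<beta>])
    moreover have "\<beta> < \<bar>u \<bullet> v\<bar> \<longleftrightarrow> \<beta> < u \<bullet> v \<or> \<beta> < (- u) \<bullet> v" for v
      unfolding inner_minus_left by linarith
    ultimately have "{z. \<beta> * norm w < \<bar>w \<bullet> (\<chi> i. z i)\<bar>}
        = {z. \<beta> < u \<bullet> (\<chi> i. z i)} \<union> {z. \<beta> < (- u) \<bullet> (\<chi> i. z i)}"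
      by blast
    also have "measure iid_normal \<dots>
        \<le> measure iid_normal {z. \<beta> < u \<bullet> (\<chi> i. z i)} + measure iid_normal {z. \<beta> < (- u) \<bullet> (\<chi> i. z i)}"
      by (rule measure_Un_le[OF half_space half_space])
    also have "\<dots> = 2 * (1 - cdf std_normal_distribution \<beta>)"
      by (simp only: one_sided[OF u(1)] one_sided[OF u(2)]) simp
    finally show ?thesis .
  qed
qed

section \<open>The chi-square law of the squared length\<close>

lemma real_distribution_chi_square: "real_distribution (chi_square_distribution k)"
proof -
  interpret prob_space "Pi\<^sub>M {..<k} (\<lambda>_. std_normal_distribution)"
    by (intro prob_space_PiM prob_space_std_normal)
  have [measurable]: "(\<lambda>z. z i) \<in> borel_measurable (Pi\<^sub>M {..<k} (\<lambda>_. std_normal_distribution))"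
    if "i < k" for i
    using measurable_component_singleton[of i "{..<k}" "\<lambda>_. std_normal_distribution"] that by simp
  show ?thesis
    unfolding chi_square_distribution_def by (intro real_distribution_distr) simp
qed

text \<open>The chi-square law is defined with the index set \<open>{..<k}\<close>, whereas vectors are indexed by
  a type with \<open>k\<close> elements; any enumeration of the type carries one product measure to the
  other and leaves the sum of squares unchanged.\<close>

lemma chi_square_distribution_eq:
  "chi_square_distribution CARD('n)
     = distr (iid_normal :: ('n::finite \<Rightarrow> real) measure) borel (\<lambda>z. (norm (\<chi> i. z i))\<^sup>2)"
proof -
  let ?K = "{..<CARD('n)}"
  obtain g :: "nat \<Rightarrow> 'n" where g: "bij_betw g ?K UNIV"
    using ex_bij_betw_nat_finite[of "UNIV :: 'n set"] by (auto simp: atLeast0LessThan)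
  have [measurable]: "(\<lambda>z. z i) \<in> borel_measurable (Pi\<^sub>M ?K (\<lambda>_. std_normal_distribution))"
    if "i \<in> ?K" for i
    using measurable_component_singleton[of i ?K "\<lambda>_. std_normal_distribution"] that by simp
  have "Pi\<^sub>M ?K (\<lambda>_. std_normal_distribution)
      = distr (iid_normal :: ('n \<Rightarrow> real) measure) (Pi\<^sub>M ?K (\<lambda>_. std_normal_distribution)) (\<lambda>z. \<lambda>k\<in>?K. z (g k))"
    by (rule distr_PiM_reindex[symmetric])
       (use g in \<open>auto simp: bij_betw_def intro: prob_space_std_normal\<close>)
  hence "chi_square_distribution CARD('n) = distr (distr (iid_normal :: ('n \<Rightarrow> real) measure)
      (Pi\<^sub>M ?K (\<lambda>_. std_normal_distribution)) (\<lambda>z. \<lambda>k\<in>?K. z (g k))) borel (\<lambda>z. \<Sum>i\<in>?K. (z i)\<^sup>2)"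
    unfolding chi_square_distribution_def by simp
  also have "\<dots> = distr (iid_normal :: ('n \<Rightarrow> real) measure) borel
      ((\<lambda>z. \<Sum>i\<in>?K. (z i)\<^sup>2) \<circ> (\<lambda>z. \<lambda>k\<in>?K. z (g k)))"
    by (rule distr_distr) (auto intro!: measurable_restrict)
  also have "\<dots> = distr (iid_normal :: ('n \<Rightarrow> real) measure) borel (\<lambda>z. (norm (\<chi> i. z i))\<^sup>2)"
  proof (rule distr_cong)
    fix z :: "'n \<Rightarrow> real"
    have "(\<Sum>k\<in>?K. (z (g k))\<^sup>2) = (\<Sum>i\<in>UNIV. (z i)\<^sup>2)"
      by (rule sum.reindex_bij_betw[OF g])
    thus "((\<lambda>z. \<Sum>i\<in>?K. (z i)\<^sup>2) \<circ> (\<lambda>z. \<lambda>k\<in>?K. z (g k))) z = (norm (\<chi> i. z i))\<^sup>2"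
      by (simp add: norm_vec_def L2_set_def sum_nonneg)
  qed auto
  finally show ?thesis .
qed

lemma iid_normal_norm_tail:
  "measure (iid_normal :: ('n::finite \<Rightarrow> real) measure) {z. q < (norm (\<chi> i. z i))\<^sup>2}
     = 1 - cdf (chi_square_distribution CARD('n)) q"
proof -
  interpret Q: real_distribution "chi_square_distribution CARD('n)"
    by (rule real_distribution_chi_square)
  have [measurable]: "(\<lambda>z. (norm (\<chi> i. z i))\<^sup>2) \<in> borel_measurable (iid_normal :: ('n \<Rightarrow> real) measure)"
    by (simp add: norm_vec_def L2_set_def sum_nonneg)
  have "measure (iid_normal :: ('n \<Rightarrow> real) measure) {z. q < (norm (\<chi> i. z i))\<^sup>2}
      = measure (chi_square_distribution CARD('n)) {q<..}"
    unfolding chi_square_distribution_eq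
    by (subst measure_distr) (auto simp: space_PiM intro!: arg_cong[where f = "measure _"])
  also have "\<dots> = measure (chi_square_distribution CARD('n)) (space (chi_square_distribution CARD('n)) - {..q})"
    by (auto intro!: arg_cong2[where f = measure])
  also have "\<dots> = 1 - cdf (chi_square_distribution CARD('n)) q"
    by (subst Q.prob_compl) (auto simp: cdf_def)
  finally show ?thesis .
qed

section \<open>Deviations of linear forms of a centred normal vector\<close>

text \<open>The first two moments are integrals against the law of the vector, hence can be computed
  from any representation \<open>b + A z\<close> of this law: the mean is \<open>b\<close> and the covariance is
  \<open>A A\<^sup>T\<close>.\<close>

lemma centred_normal_random_vector:
  fixes X :: "'a \<Rightarrow> real ^ 'n"
  assumes "normal_random_vector M X" and "mean_vector M X = 0"
  obtains A :: "real ^ 'n ^ 'n" where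
    "distr M borel X = distr iid_normal borel (\<lambda>z. A *v (\<chi> i. z i))"
    and "covariance_matrix M X = A ** transpose A"
proof -
  from assms(1) have X [measurable]: "X \<in> borel_measurable M"
    by (simp add: normal_random_vector_def)
  from assms(1) obtain b and A :: "real ^ 'n ^ 'n"
    where distr: "distr M borel X = distr iid_normal borel (\<lambda>z. b + A *v (\<chi> i. z i))"
    by (auto simp: normal_random_vector_def)
  have transfer: "(\<integral>\<omega>. f (X \<omega>) \<partial>M) = (\<integral>z. f (b + A *v (\<chi> i. z i)) \<partial>iid_normal)"
    if [measurable]: "f \<in> borel_measurable borel" for f :: "real ^ 'n \<Rightarrow> real"
  proof -
    have "(\<integral>\<omega>. f (X \<omega>) \<partial>M) = (\<integral>x. f x \<partial>distr M borel X)"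
      by (subst integral_distr) auto
    also have "\<dots> = (\<integral>z. f (b + A *v (\<chi> i. z i)) \<partial>iid_normal)"
      unfolding distr by (subst integral_distr) auto
    finally show ?thesis .
  qed
  interpret prob_space "iid_normal :: ('n \<Rightarrow> real) measure" by (rule prob_space_iid_normal)
  have coord: "(A *v (\<chi> i. z i)) $ i = (\<Sum>k\<in>UNIV. A $ i $ k * z k)" for z i
    by (simp add: matrix_vector_mult_def)
  have "b $ i = mean_vector M X $ i" for i
  proof -
    have "mean_vector M X $ i = (\<integral>z. (b + A *v (\<chi> i. z i)) $ i \<partial>iid_normal)"
      unfolding mean_vector_def using transfer[of "\<lambda>x. x $ i"] by simp
    also have "\<dots> = b $ i"
      by (simp add: coord iid_normal_mean prob_space)
    finally show ?thesis by simp
  qed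
  hence "b = 0" using assms(2) by (simp add: vec_eq_iff)
  have "covariance_matrix M X $ i $ j = (A ** transpose A) $ i $ j" for i j
  proof -
    have "covariance_matrix M X $ i $ j
        = (\<integral>z. (A *v (\<chi> i. z i)) $ i * (A *v (\<chi> i. z i)) $ j \<partial>iid_normal)"
      unfolding covariance_matrix_def using transfer[of "\<lambda>x. x $ i * x $ j"] assms(2) \<open>b = 0\<close>
      by simp
    also have "\<dots> = (\<integral>z. (\<Sum>k\<in>UNIV. \<Sum>l\<in>UNIV. A $ i $ k * A $ j $ l * (z k * z l)) \<partial>iid_normal)"
      by (simp add: coord sum_product mult_ac)
    also have "\<dots> = (\<Sum>k\<in>UNIV. \<Sum>l\<in>UNIV. A $ i $ k * A $ j $ l * (if k = l then 1 else 0))"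
      by (simp add: iid_normal_covariance del: mult_cancel_left1)
    also have "\<dots> = (A ** transpose A) $ i $ j"
      by (simp add: matrix_matrix_mult_def transpose_def if_distrib[of "\<lambda>t. _ * t"] cong: if_cong)
    finally show ?thesis .
  qed
  hence "covariance_matrix M X = A ** transpose A" by (simp add: vec_eq_iff)
  with that[of A] distr \<open>b = 0\<close> show ?thesis by simp
qed

text \<open>The passage from the random vector to \<open>z\<close> that both bounds below share: by the adjoint, a
  form \<open>v\<close> of \<open>A z\<close> is the form \<open>v v* A\<close> of \<open>z\<close>, and its standard deviation
  becomes a length. Finiteness of \<open>V\<close> makes the event measurable.\<close>

lemma centred_normal_deviation_prob_eq:
  fixes X :: "'a \<Rightarrow> real ^ 'n"
  assumes "normal_random_vector M X" and "mean_vector M X = 0" and "finite V"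
  obtains A :: "real ^ 'n ^ 'n" where
    "measure M {\<omega> \<in> space M. \<exists>v\<in>V. \<beta> * sqrt (v \<bullet> (covariance_matrix M X *v v)) < \<bar>v \<bullet> X \<omega>\<bar>}
         = measure iid_normal {z. \<exists>v\<in>V. \<beta> * norm (v v* A) < \<bar>(v v* A) \<bullet> (\<chi> i. z i)\<bar>}"
proof -
  have X [measurable]: "X \<in> borel_measurable M"
    using assms(1) by (simp add: normal_random_vector_def)
  obtain A :: "real ^ 'n ^ 'n" where
    distr: "distr M borel X = distr iid_normal borel (\<lambda>z. A *v (\<chi> i. z i))"
    and cov: "covariance_matrix M X = A ** transpose A"
    using centred_normal_random_vector[OF assms(1,2)] .
  have A [measurable]: "(\<lambda>z. A *v (\<chi> i. z i)) \<in> borel_measurable (iid_normal :: ('n \<Rightarrow> real) measure)"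
    using measurable_iid_normal_affine[of 0 A] by simp
  have std_dev: "sqrt (v \<bullet> (covariance_matrix M X *v v)) = norm (v v* A)" for v
    by (simp add: cov matrix_vector_mul_assoc[symmetric] dot_lmul_matrix[symmetric]
        norm_eq_sqrt_inner)
  have "measure M {\<omega> \<in> space M. \<exists>v\<in>V. \<beta> * sqrt (v \<bullet> (covariance_matrix M X *v v)) < \<bar>v \<bullet> X \<omega>\<bar>}
      = measure iid_normal {z. \<exists>v\<in>V. \<beta> * norm (v v* A) < \<bar>(v v* A) \<bullet> (\<chi> i. z i)\<bar>}"
  proof -
    define B where "B = {x :: real ^ 'n. \<exists>v\<in>V. \<beta> * norm (v v* A) < \<bar>v \<bullet> x\<bar>}"
    have "B = (\<Union>v\<in>V. {x. \<beta> * norm (v v* A) < \<bar>v \<bullet> x\<bar>})"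
      by (auto simp: B_def)
    also have "\<dots> \<in> sets borel"
      using \<open>finite V\<close> by (intro sets.finite_UN) measurable
    finally have [measurable]: "B \<in> sets borel" .
    have "measure M {\<omega> \<in> space M. \<exists>v\<in>V. \<beta> * sqrt (v \<bullet> (covariance_matrix M X *v v)) < \<bar>v \<bullet> X \<omega>\<bar>}
        = measure (distr M borel X) B"
      by (subst measure_distr[OF X \<open>B \<in> sets borel\<close>])
         (auto simp: B_def std_dev intro!: arg_cong[where f = "measure _"])
    also have "\<dots> = measure iid_normal {z. \<exists>v\<in>V. \<beta> * norm (v v* A) < \<bar>(v v* A) \<bullet> (\<chi> i. z i)\<bar>}"
      unfolding distr
      by (subst measure_distr[OF A \<open>B \<in> sets borel\<close>])
         (auto simp: B_def space_PiM dot_lmul_matrix intro!: arg_cong[where f = "measure _"])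
    finally show ?thesis .
  qed
  thus ?thesis by (rule that)
qed

text \<open>Cauchy-Schwarz: if some form exceeds \<open>sqrt q\<close> standard deviations, then the squared length
  of \<open>z\<close> exceeds \<open>q\<close>. The bound is therefore the same for any number of forms.\<close>

lemma centred_normal_ellipsoid_bound:
  fixes X :: "'a \<Rightarrow> real ^ 'n"
  assumes "normal_random_vector M X" and "mean_vector M X = 0" and "finite V"
  shows "measure M {\<omega> \<in> space M. \<exists>v\<in>V. sqrt q * sqrt (v \<bullet> (covariance_matrix M X *v v)) < \<bar>v \<bullet> X \<omega>\<bar>}
           \<le> 1 - cdf (chi_square_distribution CARD('n)) q"
proof -
  interpret prob_space "iid_normal :: ('n \<Rightarrow> real) measure" by (rule prob_space_iid_normal)
  obtain A :: "real ^ 'n ^ 'n" where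
    A: "measure M {\<omega> \<in> space M. \<exists>v\<in>V. sqrt q * sqrt (v \<bullet> (covariance_matrix M X *v v)) < \<bar>v \<bullet> X \<omega>\<bar>}
         = measure iid_normal {z. \<exists>v\<in>V. sqrt q * norm (v v* A) < \<bar>(v v* A) \<bullet> (\<chi> i. z i)\<bar>}"
    using centred_normal_deviation_prob_eq[OF assms] .
  have "measure iid_normal {z. \<exists>v\<in>V. sqrt q * norm (v v* A) < \<bar>(v v* A) \<bullet> (\<chi> i. z i)\<bar>}
      \<le> measure iid_normal {z::'n \<Rightarrow> real. q < (norm (\<chi> i. z i))\<^sup>2}"
  proof (rule finite_measure_mono)
    have "q < (norm u)\<^sup>2" if "sqrt q * norm w < \<bar>w \<bullet> u\<bar>" for u w :: "real ^ 'n"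
    proof (rule ccontr)
      assume "\<not> q < (norm u)\<^sup>2"
      hence "norm u \<le> sqrt q" by (simp add: real_le_rsqrt)
      hence "norm w * norm u \<le> norm w * sqrt q" by (rule mult_left_mono) simp
      with that Cauchy_Schwarz_ineq2[of w u] show False by (simp add: mult.commute)
    qed
    thus "{z. \<exists>v\<in>V. sqrt q * norm (v v* A) < \<bar>(v v* A) \<bullet> (\<chi> i. z i)\<bar>}
        \<subseteq> {z. q < (norm (\<chi> i. z i))\<^sup>2}" by blast
    have "(\<lambda>z. (norm (\<chi> i. z i))\<^sup>2) \<in> borel_measurable (iid_normal :: ('n \<Rightarrow> real) measure)"
      by (simp add: norm_vec_def L2_set_def sum_nonneg)
    from borel_measurable_less[OF borel_measurable_const this, of q]
    show "{z::'n \<Rightarrow> real. q < (norm (\<chi> i. z i))\<^sup>2} \<in> events"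
      by (simp add: space_PiM)
  qed
  also have "\<dots> = 1 - cdf (chi_square_distribution CARD('n)) q"
    by (rule iid_normal_norm_tail)
  finally show ?thesis by (simp add: A)
qed

lemma centred_normal_union_bound:
  fixes X :: "'a \<Rightarrow> real ^ 'n"
  assumes "normal_random_vector M X" and "mean_vector M X = 0" and "finite V"
  shows "measure M {\<omega> \<in> space M. \<exists>v\<in>V. \<beta> * sqrt (v \<bullet> (covariance_matrix M X *v v)) < \<bar>v \<bullet> X \<omega>\<bar>}
           \<le> real (card V) * (2 * (1 - cdf std_normal_distribution \<beta>))"
proof -
  interpret prob_space "iid_normal :: ('n \<Rightarrow> real) measure" by (rule prob_space_iid_normal)
  obtain A :: "real ^ 'n ^ 'n" where
    A: "measure M {\<omega> \<in> space M. \<exists>v\<in>V. \<beta> * sqrt (v \<bullet> (covariance_matrix M X *v v)) < \<bar>v \<bullet> X \<omega>\<bar>}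
         = measure iid_normal {z. \<exists>v\<in>V. \<beta> * norm (v v* A) < \<bar>(v v* A) \<bullet> (\<chi> i. z i)\<bar>}"
    using centred_normal_deviation_prob_eq[OF assms] .
  define F where "F v = {z. \<beta> * norm (v v* A) < \<bar>(v v* A) \<bullet> (\<chi> i. z i)\<bar>}" for v
  have F: "F v \<in> events" for v
  proof -
    have "Measurable.pred (iid_normal :: ('n \<Rightarrow> real) measure)
            (\<lambda>z. \<beta> * norm (v v* A) < \<bar>(v v* A) \<bullet> (\<chi> i. z i)\<bar>)"
      by measurable
    thus ?thesis by (simp add: pred_def F_def space_PiM)
  qed
  have "{z. \<exists>v\<in>V. \<beta> * norm (v v* A) < \<bar>(v v* A) \<bullet> (\<chi> i. z i)\<bar>} = (\<Union>v\<in>V. F v)"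
    by (auto simp: F_def)
  also have "measure iid_normal \<dots> \<le> (\<Sum>v\<in>V. measure iid_normal (F v))"
    using F \<open>finite V\<close> by (intro finite_measure_subadditive_finite) auto
  also have "\<dots> \<le> (\<Sum>v\<in>V. 2 * (1 - cdf std_normal_distribution \<beta>))"
    unfolding F_def by (intro sum_mono iid_normal_form_tail)
  also have "\<dots> = real (card V) * (2 * (1 - cdf std_normal_distribution \<beta>))" by simp
  finally show ?thesis by (simp add: A)
qed

section \<open>The uncertainty set\<close>

text \<open>The uncertainty set has one inequality for each ordered pair of adjacent vertices, that is,
  two for each edge. The union bound has to be taken over \<open>|E| + n\<close> forms, so each edge is given
  an orientation and the symmetry of \<open>\<gamma>\<close> supplies the inequality for the opposite one.\<close>

lemma uncertainty_set_from_few_linear_forms: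
  fixes E :: "'n::finite set set" and \<gamma> :: "'n \<Rightarrow> 'n \<Rightarrow> real"
  assumes two: "\<And>e. e \<in> E \<Longrightarrow> card e = 2"
    and sym: "\<And>i j. {i, j} \<in> E \<Longrightarrow> \<gamma> i j = \<gamma> j i"
    and ge: "\<And>i j. {i, j} \<in> E \<or> i = j \<Longrightarrow> r (edge_vector i j) \<le> \<gamma> i j"
  obtains V :: "(real ^ 'n) set" where "finite V" "card V \<le> card E + CARD('n)"
    "\<And>\<delta>. (\<And>v. v \<in> V \<Longrightarrow> \<bar>v \<bullet> \<delta>\<bar> \<le> r v) \<Longrightarrow> \<delta> \<in> uncertainty_set E \<gamma>"
proof -
  have "\<forall>e\<in>E. \<exists>i j. i \<noteq> j \<and> e = {i, j}"
    using two by (force simp: card_2_iff)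
  then obtain s t where st: "\<And>e. e \<in> E \<Longrightarrow> s e \<noteq> t e \<and> e = {s e, t e}"
    by metis
  define V where "V = (\<lambda>e. edge_vector (s e) (t e)) ` E \<union> range (\<lambda>i. edge_vector i i)"
  have inner_edge: "edge_vector i j \<bullet> \<delta> = (if i = j then \<delta> $ i else \<delta> $ i - \<delta> $ j)"
    for i j :: 'n and \<delta>
    by (simp add: edge_vector_def inner_diff_left inner_axis')
  have "card V \<le> card E + CARD('n)"
    unfolding V_def
    by (rule order_trans[OF card_Un_le]) (intro add_mono card_image_le, auto)
  moreover have "\<delta> \<in> uncertainty_set E \<gamma>" if \<delta>: "\<And>v. v \<in> V \<Longrightarrow> \<bar>v \<bullet> \<delta>\<bar> \<le> r v" for \<delta>
    unfolding uncertainty_set_def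
  proof (intro CollectI conjI allI impI)
    fix i
    have "\<bar>edge_vector i i \<bullet> \<delta>\<bar> \<le> r (edge_vector i i)"
      by (rule \<delta>) (simp add: V_def)
    also have "\<dots> \<le> \<gamma> i i" by (simp add: ge)
    finally show "\<bar>\<delta> $ i\<bar> \<le> \<gamma> i i" by (simp add: inner_edge)
  next
    fix i j assume e: "{i, j} \<in> E"
    define a b where "a = s {i, j}" and "b = t {i, j}"
    have ab: "a \<noteq> b" "{i, j} = {a, b}"
      using st[OF e] by (auto simp: a_def b_def)
    have "\<bar>edge_vector a b \<bullet> \<delta>\<bar> \<le> r (edge_vector a b)"
      by (rule \<delta>) (use e in \<open>auto simp: V_def a_def b_def\<close>)
    also have "\<dots> \<le> \<gamma> a b" using e ab by (intro ge) simp
    finally have "\<bar>\<delta> $ a - \<delta> $ b\<bar> \<le> \<gamma> a b" using ab by (simp add: inner_edge)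
    moreover have "(i = a \<and> j = b) \<or> (i = b \<and> j = a)"
      using ab by (auto simp: doubleton_eq_iff)
    ultimately show "\<bar>\<delta> $ i - \<delta> $ j\<bar> \<le> \<gamma> i j"
      using sym[OF e] by (auto simp: abs_minus_commute)
  qed
  ultimately show ?thesis using that[of V] by (auto simp: V_def)
qed

section \<open>The probability guarantee\<close>

theorem corollary3:
  fixes M :: "'a measure"
    and X :: "'a \<Rightarrow> real ^ 'n"
    and \<Sigma> :: "real ^ 'n ^ 'n"
    and E :: "'n set set"
    and Z :: "((real ^ 'nx) \<times> (real ^ 'ny)) set"
    and m :: nat
    and C :: "nat \<Rightarrow> real ^ 'nx ^ 'n"
    and d :: "nat \<Rightarrow> real ^ 'ny"
    and c :: "nat \<Rightarrow> real"
    and p \<beta> :: real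
    and \<gamma> :: "'n \<Rightarrow> 'n \<Rightarrow> real"
    and x :: "real ^ 'nx"
    and y :: "real ^ 'ny"
  assumes "prob_space M"
    and "normal_random_vector M X"
    and "mean_vector M X = 0"
    and "covariance_matrix M X = \<Sigma>"
    and "invertible \<Sigma>"
    and "\<And>i. \<Sigma> $ i $ i = 1"
    and "\<And>e. e \<in> E \<Longrightarrow> card e = 2"
    and "Z \<subseteq> {u. \<forall>k. 0 \<le> u $ k} \<times> {v. \<forall>k. 0 \<le> v $ k}"
    and "0 < p" and "p < 1"
    and "\<beta> = min (sqrt (quantile (chi_square_distribution CARD('n)) (1 - p)))
                 (quantile std_normal_distribution
                    (1 - p / (2 * (real (card E) + real CARD('n)))))"
    and "\<And>i j. {i, j} \<in> E \<Longrightarrow> \<gamma> i j = \<gamma> j i"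
    and "\<And>i j. {i, j} \<in> E \<or> i = j \<Longrightarrow>
           \<gamma> i j \<ge> \<beta> * sqrt (edge_vector i j \<bullet> (\<Sigma> *v edge_vector i j))"
    and "(x, y) \<in> Z"
    and "\<And>i \<delta>. i \<in> {1..m} \<Longrightarrow> \<delta> \<in> uncertainty_set E \<gamma> \<Longrightarrow>
           \<delta> \<bullet> (C i *v x) + d i \<bullet> y \<le> c i"
  shows "measure M {\<omega> \<in> space M. \<exists>i\<in>{1..m}. \<not> (X \<omega> \<bullet> (C i *v x) + d i \<bullet> y \<le> c i)} \<le> p"
proof -
  interpret prob_space M by fact
  note normal = assms(2,3) and cov = assms(4)
  have [measurable]: "X \<in> borel_measurable M"
    using normal(1) by (simp add: normal_random_vector_def)
  define r where "r v = \<beta> * sqrt (v \<bullet> (\<Sigma> *v v))" for v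
  obtain V where V: "finite V" "card V \<le> card E + CARD('n)"
    and in_U: "\<And>\<delta>. (\<And>v. v \<in> V \<Longrightarrow> \<bar>v \<bullet> \<delta>\<bar> \<le> r v) \<Longrightarrow> \<delta> \<in> uncertainty_set E \<gamma>"
    by (rule uncertainty_set_from_few_linear_forms[of E \<gamma> r, OF assms(7,12)])
       (use assms(13) in \<open>auto simp: r_def\<close>)
  \<comment> \<open>\<open>F\<close> contains the event that the vector leaves the uncertainty set.\<close>
  define F where "F = {\<omega> \<in> space M. \<exists>v\<in>V. r v < \<bar>v \<bullet> X \<omega>\<bar>}"
  have "F = (\<Union>v\<in>V. {\<omega> \<in> space M. r v < \<bar>v \<bullet> X \<omega>\<bar>})"
    by (auto simp: F_def)
  also have "\<dots> \<in> events"
    using V(1) by (intro sets.finite_UN) measurable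
  finally have F: "F \<in> events" .
  define N where "N = real (card E) + real CARD('n)"
  have "1 \<le> real CARD('n)" by (simp add: Suc_leI)
  moreover have "real (card V) \<le> real (card E + CARD('n))"
    using V(2) by (simp only: of_nat_le_iff)
  ultimately have N: "1 \<le> N" "real (card V) \<le> N"
    by (simp_all only: N_def of_nat_add)
  have "\<beta> = sqrt (quantile (chi_square_distribution CARD('n)) (1 - p))
      \<or> \<beta> = quantile std_normal_distribution (1 - p / (2 * N))"
    using assms(11) unfolding N_def min_def by presburger
  hence "prob F \<le> p"
  proof
    assume \<beta>: "\<beta> = sqrt (quantile (chi_square_distribution CARD('n)) (1 - p))"
    have "prob F \<le> 1 - cdf (chi_square_distribution CARD('n))
                        (quantile (chi_square_distribution CARD('n)) (1 - p))"
      using centred_normal_ellipsoid_bound[OF normal V(1)] unfolding F_def r_def \<beta> cov by blast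
    also have "\<dots> \<le> p"
      using le_cdf_quantile[OF real_distribution_chi_square, of "1 - p" "CARD('n)"] \<open>0 < p\<close> \<open>p < 1\<close>
      by simp
    finally show ?thesis .
  next
    assume \<beta>: "\<beta> = quantile std_normal_distribution (1 - p / (2 * N))"
    have "p / (2 * N) < 1" "0 < p / (2 * N)"
      using \<open>0 < p\<close> \<open>p < 1\<close> N(1) by (simp_all add: field_simps)
    hence tail: "1 - cdf std_normal_distribution \<beta> \<le> p / (2 * N)"
      using le_cdf_quantile[OF real_dist_normal_dist, of "1 - p / (2 * N)"] by (simp add: \<beta>)
    have "prob F \<le> real (card V) * (2 * (1 - cdf std_normal_distribution \<beta>))"
      using centred_normal_union_bound[OF normal V(1), of \<beta>] unfolding F_def r_def cov by blast
    also have "\<dots> \<le> real (card V) * (2 * (p / (2 * N)))"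
      using tail by (intro mult_left_mono) auto
    also have "\<dots> \<le> N * (2 * (p / (2 * N)))"
      using N \<open>0 < p\<close> by (intro mult_right_mono) auto
    also have "\<dots> = p" using N(1) by simp
    finally show ?thesis .
  qed
  moreover have "{\<omega> \<in> space M. \<exists>i\<in>{1..m}. \<not> (X \<omega> \<bullet> (C i *v x) + d i \<bullet> y \<le> c i)} \<subseteq> F"
  proof
    fix \<omega> assume "\<omega> \<in> {\<omega> \<in> space M. \<exists>i\<in>{1..m}. \<not> (X \<omega> \<bullet> (C i *v x) + d i \<bullet> y \<le> c i)}"
    hence \<omega>: "\<omega> \<in> space M" and "X \<omega> \<notin> uncertainty_set E \<gamma>"
      using assms(15) by blast+
    then obtain v where "v \<in> V" "\<not> \<bar>v \<bullet> X \<omega>\<bar> \<le> r v"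
      using in_U by blast
    with \<omega> show "\<omega> \<in> F" unfolding F_def not_le by blast
  qed
  hence "prob {\<omega> \<in> space M. \<exists>i\<in>{1..m}. \<not> (X \<omega> \<bullet> (C i *v x) + d i \<bullet> y \<le> c i)} \<le> prob F"
    using F by (rule finite_measure_mono)
  ultimately show ?thesis by linarith
qed

end
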